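(* Let $\mathcal{F}=(E_1|H_1,\ldots,E_n|H_n)$ be any sequence of $n$ conditional events, let $\Pi\subseteq[0,1]^n$ be the (non-empty) set of all coherent precise assessments on $\mathcal{F}$, and let $\pi(\mathcal{I})=\Pi\cap\mathcal{I}$ for $\mathcal{I}\subseteq[0,1]^n$. Let $(s_1,s_2,s_3,s_4)$ be a quadruple of sentences $s_k:(\mathcal{F},\mathcal{I}_k)$ with $\mathcal{I}_k\subseteq[0,1]^n$, $k=1,2,3,4$. Define $\mathcal{D}_1=\pi(\mathcal{I}_1)$, $\mathcal{D}_2=\pi(\mathcal{I}_2)$, and $\mathcal{D}_3=\pi(\mathcal{I}_3)\cap\pi(\mathcal{I}_4)$. Then $(s_1,s_2,s_3,s_4)$ is a square of opposition if and only if $(\mathcal{D}_1,\mathcal{D}_2,\mathcal{D}_3)$ is a tripartition of $\Pi$ such that $\pi(\mathcal{I}_3)=\mathcal{D}_1\cup\mathcal{D}_3$ and $\pi(\mathcal{I}_4)=\mathcal{D}_2\cup\mathcal{D}_3$.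
   Context: Events are two-valued logical entities (they can be modelled as subsets of a nonempty set $\Omega$ of possible cases); an event is identified with its indicator in $\{0,1\}$. A conditional event $E|H$ is given by events $E,H$ with $H\neq\bot$ (impossible event). Given $\mathcal{F}=(E_1|H_1,\ldots,E_n|H_n)$, a precise assessment on $\mathcal{F}$ is a vector $\mathcal{P}=(p_1,\ldots,p_n)$, $p_i=p(E_i|H_i)$. It is coherent iff for every nonempty subfamily, indexed by $J\subseteq\{1,\ldots,n\}$, and all real numbers $s_j$ ($j\in J$), the random gain $\mathcal{G}=\sum_{j\in J}s_jH_j(E_j-p_j)$ satisfies $\min G\le 0\le\max G$, where $G$ is the set of values of $\mathcal{G}$ restricted to $\bigvee_{j\in J}H_j$ being true. $\Pi$ denotes the set of all coherent precise assessments on $\mathcal{F}$; it is known that $\emptyset\neq\Pi\subseteq[0,1]^n$. An imprecise assessment on $\mathcal{F}$ is any (possibly empty) subset $\mathcal{I}\subseteq[0,1]^n$. A sentence is a pair $s:(\mathcal{F},\mathcal{I})$. A quadruple $(s_1,s_2,s_3,s_4)$ of sentences $s_k:(\mathcal{F},\mathcal{I}_k)$ is a square of opposition (under coherence) iff: (a) $s_1,s_2$ are contraries: $\pi(\mathcal{I}_1)\cap\pi(\mathcal{I}_2)=\emptyset$; (b) $s_3,s_4$ are subcontraries: $\pi(\mathcal{I}_3)\cup\pi(\mathcal{I}_4)=\Pi$; (c) $s_1,s_4$ are contradictories: $\pi(\mathcal{I}_1)\cap\pi(\mathcal{I}_4)=\emptyset$ and $\pi(\mathcal{I}_1)\cup\pi(\mathcal{I}_4)=\Pi$;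 and $s_2,s_3$ are contradictories: $\pi(\mathcal{I}_2)\cap\pi(\mathcal{I}_3)=\emptyset$ and $\pi(\mathcal{I}_2)\cup\pi(\mathcal{I}_3)=\Pi$; (d) $s_3$ is a subaltern of $s_1$: $\pi(\mathcal{I}_1)\subseteq\pi(\mathcal{I}_3)$; and $s_4$ is a subaltern of $s_2$: $\pi(\mathcal{I}_2)\subseteq\pi(\mathcal{I}_4)$. A tripartition of a set $S$ is an ordered triple $(\mathcal{D}_1,\mathcal{D}_2,\mathcal{D}_3)$ of (possibly empty) pairwise disjoint subsets of $S$ with $\mathcal{D}_1\cup\mathcal{D}_2\cup\mathcal{D}_3=S$. *)

theory Defs
  imports "HOL-Analysis.Analysis"
begin

text \<open>
  The type \<open>'w\<close> is the nonempty set of possible cases, events are sets over it, and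
  the pair \<open>(E, H)\<close> stands for the conditional event \<open>E|H\<close>. The requirement
  \<open>H \<noteq> {}\<close> is the predicate \<open>conditional_event\<close>. The families have length \<open>CARD('n)\<close>.
\<close>

type_synonym 'w cond_event = "'w set \<times> 'w set"

type_synonym ('w, 'n) family = "'w cond_event ^ 'n"

definition conditional_event :: "'w cond_event \<Rightarrow> bool" where
  "conditional_event C \<longleftrightarrow> snd C \<noteq> {}"

definition gain ::
  "('w, 'n::finite) family \<Rightarrow> real ^ 'n \<Rightarrow> 'n set \<Rightarrow> ('n \<Rightarrow> real) \<Rightarrow> 'w \<Rightarrow> real" where
  "gain F P J s w =
     (\<Sum>j\<in>J. s j * indicator (snd (F $ j)) w * (indicator (fst (F $ j)) w - P $ j))"

definition gain_values ::
  "('w, 'n::finite) family \<Rightarrow> real ^ 'n \<Rightarrow> 'n set \<Rightarrow> ('n \<Rightarrow> real) \<Rightarrow> real set" where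
  "gain_values F P J s = gain F P J s ` (\<Union>j\<in>J. snd (F $ j))"

text \<open>
  \<open>Min\<close> and \<open>Max\<close> below are meaningful: the set of gain values is finite even if
  \<open>'w\<close> is infinite (\<open>finite_gain_values\<close>), and it is nonempty for nonempty \<open>J\<close> if every
  conditioning event is possible.
\<close>

definition coherent :: "('w, 'n::finite) family \<Rightarrow> real ^ 'n \<Rightarrow> bool" where
  "coherent F P \<longleftrightarrow>
     (\<forall>J s. J \<noteq> {} \<longrightarrow>
        Min (gain_values F P J s) \<le> 0 \<and> 0 \<le> Max (gain_values F P J s))"

definition coherent_assessments :: "('w, 'n::finite) family \<Rightarrow> (real ^ 'n) set" where
  "coherent_assessments F = {P. coherent F P}"

type_synonym ('w, 'n) sentence = "('w, 'n) family \<times> (real ^ 'n) set"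

text \<open>The box \<open>cbox 0 1\<close> in \<open>real ^ 'n\<close> is the unit cube, as \<open>1\<close> is the all-ones vector.\<close>

definition is_sentence :: "('w, 'n::finite) sentence \<Rightarrow> bool" where
  "is_sentence s \<longleftrightarrow> (\<forall>i. conditional_event (fst s $ i)) \<and> snd s \<subseteq> cbox 0 1"

definition coherent_part :: "('w, 'n::finite) family \<Rightarrow> (real ^ 'n) set \<Rightarrow> (real ^ 'n) set" where
  "coherent_part F I = coherent_assessments F \<inter> I"

text \<open>Each of the following relations presupposes that both sentences are on the same family.\<close>

definition contraries :: "('w, 'n::finite) sentence \<Rightarrow> ('w, 'n) sentence \<Rightarrow> bool" where
  "contraries s t \<longleftrightarrow> fst s = fst t \<and>
     coherent_part (fst s) (snd s) \<inter> coherent_part (fst t) (snd t) = {}"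

definition subcontraries :: "('w, 'n::finite) sentence \<Rightarrow> ('w, 'n) sentence \<Rightarrow> bool" where
  "subcontraries s t \<longleftrightarrow> fst s = fst t \<and>
     coherent_part (fst s) (snd s) \<union> coherent_part (fst t) (snd t) = coherent_assessments (fst s)"

definition contradictories :: "('w, 'n::finite) sentence \<Rightarrow> ('w, 'n) sentence \<Rightarrow> bool" where
  "contradictories s t \<longleftrightarrow> fst s = fst t \<and>
     coherent_part (fst s) (snd s) \<inter> coherent_part (fst t) (snd t) = {} \<and>
     coherent_part (fst s) (snd s) \<union> coherent_part (fst t) (snd t) = coherent_assessments (fst s)"

text \<open>\<open>subaltern t s\<close> reads: \<open>t\<close> is a subaltern of \<open>s\<close>.\<close>

definition subaltern :: "('w, 'n::finite) sentence \<Rightarrow> ('w, 'n) sentence \<Rightarrow> bool" where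
  "subaltern t s \<longleftrightarrow> fst s = fst t \<and>
     coherent_part (fst s) (snd s) \<subseteq> coherent_part (fst t) (snd t)"

definition square_of_opposition ::
  "('w, 'n::finite) sentence \<Rightarrow> ('w, 'n) sentence \<Rightarrow> ('w, 'n) sentence \<Rightarrow> ('w, 'n) sentence \<Rightarrow> bool"
  where
  "square_of_opposition s1 s2 s3 s4 \<longleftrightarrow>
     contraries s1 s2 \<and>
     subcontraries s3 s4 \<and>
     contradictories s1 s4 \<and> contradictories s2 s3 \<and>
     subaltern s3 s1 \<and> subaltern s4 s2"

definition tripartition :: "'a set \<Rightarrow> 'a set \<Rightarrow> 'a set \<Rightarrow> 'a set \<Rightarrow> bool" where
  "tripartition S D1 D2 D3 \<longleftrightarrow>
     D1 \<inter> D2 = {} \<and> D1 \<inter> D3 = {} \<and> D2 \<inter> D3 = {} \<and> D1 \<union> D2 \<union> D3 = S"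

lemma finite_gain_values:
  fixes F :: "('w, 'n::finite) family"
  shows "finite (gain_values F P J s)"
proof -
  define atom where "atom w = ({j. w \<in> fst (F $ j)}, {j. w \<in> snd (F $ j)})" for w
  define g where "g = (\<lambda>(A, B). \<Sum>j\<in>J. s j * indicator B j * (indicator A j - P $ j))"
  have "gain F P J s w = g (atom w)" for w
    unfolding gain_def g_def atom_def by (auto simp: indicator_def intro!: sum.cong)
  then have "gain_values F P J s \<subseteq> range g"
    unfolding gain_values_def by auto
  then show ?thesis
    by (rule finite_subset) simp
qed

lemma coherent_assessments_subset:
  fixes F :: "('w, 'n::finite) family"
  assumes "\<And>i. conditional_event (F $ i)"
  shows "coherent_assessments F \<subseteq> cbox 0 1"
proof
  fix P assume "P \<in> coherent_assessments F"
  then have coh: "coherent F P" by (simp add: coherent_assessments_def)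
  have "0 \<le> P $ i \<and> P $ i \<le> 1" for i
  proof -
    let ?G = "gain_values F P {i} (\<lambda>_. 1)"
    have ne: "?G \<noteq> {}"
      using assms[of i] by (auto simp: gain_values_def conditional_event_def)
    have vals: "- P $ i \<le> v \<and> v \<le> 1 - P $ i" if "v \<in> ?G" for v
      using that by (auto simp: gain_values_def gain_def indicator_def)
    have "Min ?G \<le> 0" "0 \<le> Max ?G"
      using coh by (auto simp: coherent_def)
    moreover have "Min ?G \<in> ?G" "Max ?G \<in> ?G"
      using Min_in[OF finite_gain_values ne] Max_in[OF finite_gain_values ne] .
    ultimately show ?thesis
      using vals[of "Min ?G"] vals[of "Max ?G"] by linarith
  qed
  then show "P \<in> cbox 0 1"
    by (simp add: mem_box_cart)
qed

text \<open>
  A coherent assessment: order finitely many cases so that each \<open>H\<^sub>i\<close> contains at least one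
  of them, and let \<open>p\<^sub>i\<close> be the truth value of \<open>E\<^sub>i\<close> at the first one in \<open>H\<^sub>i\<close>.
\<close>

lemma coherent_assessments_nonempty:
  fixes F :: "('w, 'n::finite) family"
  assumes "\<And>i. conditional_event (F $ i)"
  shows "coherent_assessments F \<noteq> {}"
proof -
  obtain r where r: "r i \<in> snd (F $ i)" for i
  proof
    show "(SOME w. w \<in> snd (F $ i)) \<in> snd (F $ i)" for i
      using assms[of i] by (auto simp: conditional_event_def intro: someI)
  qed
  obtain ws where ws: "set ws = range r"
    using finite_list[of "range r"] by auto
  have hit: "\<exists>k. k < length ws \<and> ws ! k \<in> snd (F $ i)" for i
    using r[of i] ws by (metis in_set_conv_nth rangeI)
  define k where "k i = (LEAST m. m < length ws \<and> ws ! m \<in> snd (F $ i))" for i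
  have k: "k i < length ws" "ws ! k i \<in> snd (F $ i)" for i
    using LeastI_ex[OF hit[of i]] unfolding k_def by auto
  have k_le: "k i \<le> m" if "m < length ws" "ws ! m \<in> snd (F $ i)" for i m
    unfolding k_def using that by (intro Least_le) auto
  define P :: "real ^ 'n" where "P = (\<chi> i. indicator (fst (F $ i)) (ws ! k i))"
  have "coherent F P"
    unfolding coherent_def
  proof (intro allI impI)
    fix J :: "'n set" and s :: "'n \<Rightarrow> real"
    assume J: "J \<noteq> {}"
    obtain i where i: "i \<in> J" "\<And>j. j \<in> J \<Longrightarrow> k i \<le> k j"
      using arg_min_if_finite(1)[of J k] arg_min_least[of J _ k] J by auto
    have "gain F P J s (ws ! k i) = 0"
      unfolding gain_def
    proof (intro sum.neutral ballI)
      fix j assume j: "j \<in> J"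
      show "s j * indicator (snd (F $ j)) (ws ! k i) *
              (indicator (fst (F $ j)) (ws ! k i) - P $ j) = 0"
      proof (cases "ws ! k i \<in> snd (F $ j)")
        case True
        then have "k j = k i"
          using k_le[of "k i" j] k(1)[of i] i(2)[OF j] by auto
        then show ?thesis by (simp add: P_def)
      qed simp
    qed
    then have "0 \<in> gain_values F P J s"
      unfolding gain_values_def using i(1) k(2)[of i] by (intro image_eqI) auto
    then show "Min (gain_values F P J s) \<le> 0 \<and> 0 \<le> Max (gain_values F P J s)"
      using Min_le[OF finite_gain_values] Max_ge[OF finite_gain_values] by blast
  qed
  then show ?thesis by (auto simp: coherent_assessments_def)
qed

end

theory Submission
  imports Defs
begin

text \<open>
  The square is determined by its top edge. Write \<open>\<Pi>\<close> for the set of coherent assessments and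
  \<open>A\<^sub>k \<subseteq> \<Pi>\<close> for the coherent part of the \<open>k\<close>-th sentence. The two contradictory diagonals say
  exactly that \<open>A\<^sub>4 = \<Pi> - A\<^sub>1\<close> and \<open>A\<^sub>3 = \<Pi> - A\<^sub>2\<close>. The remaining conditions then express one and
  the same thing, the disjointness of \<open>A\<^sub>1\<close> and \<open>A\<^sub>2\<close>: by complementation, it says that \<open>A\<^sub>3\<close> and
  \<open>A\<^sub>4\<close> cover \<open>\<Pi>\<close>, that \<open>A\<^sub>1 \<subseteq> A\<^sub>3\<close>, and that \<open>A\<^sub>2 \<subseteq> A\<^sub>4\<close>. So a square is a pair of disjoint
  sets \<open>A\<^sub>1\<close>, \<open>A\<^sub>2\<close> with their complements on the opposite corners
  (\<open>square_of_opposition_iff_complements\<close>).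

  A tripartition of \<open>\<Pi>\<close> is likewise a pair of disjoint sets together with the rest of \<open>\<Pi>\<close>. Here
  that rest is \<open>A\<^sub>3 \<inter> A\<^sub>4 = \<Pi> - (A\<^sub>1 \<union> A\<^sub>2)\<close>, and the complement of one of the first two parts is
  the union of the other two parts (\<open>complements_iff_tripartition\<close>).
\<close>

lemma square_of_opposition_iff_complements:
  "square_of_opposition (F, I1) (F, I2) (F, I3) (F, I4) \<longleftrightarrow>
    coherent_part F I1 \<inter> coherent_part F I2 = {} \<and>
    coherent_part F I3 = coherent_assessments F - coherent_part F I2 \<and>
    coherent_part F I4 = coherent_assessments F - coherent_part F I1"
proof -
  have "coherent_part F I \<subseteq> coherent_assessments F" for I
    by (simp add: coherent_part_def)
  from this[of I1] this[of I2] this[of I3] this[of I4] show ?thesis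
    unfolding square_of_opposition_def contraries_def subcontraries_def
      contradictories_def subaltern_def fst_conv snd_conv
    by blast
qed

text \<open>
  Under the tripartition, \<open>A \<union> (C \<inter> D)\<close> is \<open>S - B\<close> and \<open>B \<union> (C \<inter> D)\<close> is \<open>S - A\<close>, so the
  two equations on the right turn into the ones on the left. Conversely, the equations on the left
  give \<open>C \<inter> D = S - (A \<union> B)\<close>, the rest of \<open>S\<close>.
\<close>

lemma complements_iff_tripartition:
  assumes "A \<subseteq> S" and "B \<subseteq> S"
  shows "A \<inter> B = {} \<and> C = S - B \<and> D = S - A \<longleftrightarrow>
    tripartition S A B (C \<inter> D) \<and> C = A \<union> (C \<inter> D) \<and> D = B \<union> (C \<inter> D)"
  using assms unfolding tripartition_def by blast

theorem theorem1:
  fixes F :: "('w, 'n::finite) family"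
    and I1 I2 I3 I4 D1 D2 D3 :: "(real ^ 'n) set"
  assumes "is_sentence (F, I1)" and "is_sentence (F, I2)"
    and "is_sentence (F, I3)" and "is_sentence (F, I4)"
    and "D1 = coherent_part F I1"
    and "D2 = coherent_part F I2"
    and "D3 = coherent_part F I3 \<inter> coherent_part F I4"
  shows "square_of_opposition (F, I1) (F, I2) (F, I3) (F, I4) \<longleftrightarrow>
    tripartition (coherent_assessments F) D1 D2 D3 \<and>
    coherent_part F I3 = D1 \<union> D3 \<and> coherent_part F I4 = D2 \<union> D3"
  unfolding assms(5-7) square_of_opposition_iff_complements
  by (rule complements_iff_tripartition) (simp_all add: coherent_part_def)

end
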